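(* Let $\{Y_t\}_{t\ge0}$ be a sequence of random variables and $X_t:=Y_t-Y_{t-1}$ for $t\ge1$. Suppose there exist $\gamma\in(0,\tfrac12]$, $\beta_u,\beta_l\ge0$ and $\sigma>0$ such that for all $t\ge1$: (1) $|X_t|\le1$ with probability one; (2) $-\gamma Y_{t-1}-\beta_l\le\mathbb{E}[X_t\mid Y_0,\dots,Y_{t-1}]\le-\gamma Y_{t-1}+\beta_u$; (3) $\mathbb{E}[X_t^2\mid Y_0,\dots,Y_{t-1}]\le\gamma Y_{t-1}+\sigma$; (4) for every $a\in[-1,1]$, $\mathbb{E}[e^{aY_0}]\le e^{a^2\sigma/\gamma}$. Then for any $\eta>0$ and any $t\ge0$, \[\Pr\Big[Y_t\ge\frac{\beta_u}{\gamma}+\eta\Big]\le\exp\Big[-\frac{\eta^2}{4(\sigma+\beta_u)/\gamma+2\eta}\Big]\] and \[\Pr\Big[Y_t\le-\frac{\beta_l}{\gamma}-\eta\Big]\le\exp\Big[-\frac{\eta^2}{4\sigma/\gamma+\eta}\Big].\] *)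

theory Defs
  imports "HOL-Probability.Probability"
begin

definition increment :: "(nat \<Rightarrow> 'a \<Rightarrow> real) \<Rightarrow> nat \<Rightarrow> 'a \<Rightarrow> real" where
  "increment Y t \<omega> = Y t \<omega> - Y (t - 1) \<omega>"

(* The index t is exclusive: this is the sigma-algebra generated by Y 0, ..., Y (t - 1). *)
definition past_algebra :: "'a measure \<Rightarrow> (nat \<Rightarrow> 'a \<Rightarrow> real) \<Rightarrow> nat \<Rightarrow> 'a measure" where
  "past_algebra M Y t = sigma (space M) {Y s -` B \<inter> space M | s B. s < t \<and> B \<in> sets borel}"

end

theory Submission
  imports Defs
begin

text \<open>
  For \<open>\<bar>a\<bar> \<le> 1\<close>, the inequality \<open>exp z \<le> 1 + z + z\<^sup>2\<close> applied to \<open>z = a * X\<^sub>t\<close> turns the bounds on the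
  two conditional moments into \<open>E (exp (a * Y\<^sub>t)) \<le> exp (d a) * E (exp (b a * Y\<^sub>t\<^sub>-\<^sub>1))\<close>, where the map \<open>b\<close>
  contracts \<open>a\<close> towards \<open>0\<close>. A function \<open>G\<close> with \<open>G (b a) + d a \<le> G a\<close> that bounds the logarithm of the
  moment generating function at time \<open>0\<close> therefore bounds it at all times. For the upper tail take
  \<open>G a = (\<beta>\<^sub>u / \<gamma>) * a + ((\<sigma> + \<beta>\<^sub>u) / \<gamma>) * a\<^sup>2 / (1 - a)\<close> on \<open>[0, 1)\<close>, for the lower tail
  \<open>G (- a) = (\<beta>\<^sub>l / \<gamma>) * a + (\<sigma> / \<gamma>) * a\<^sup>2\<close> on \<open>[0, 1]\<close>, and conclude with Chernoff's bound.
\<close>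

section \<open>One-step estimate for exponential moments\<close>

lemma exp_le_quadratic:
  fixes z :: real
  assumes "\<bar>z\<bar> \<le> 1"
  shows "exp z \<le> 1 + z + z\<^sup>2"
proof (cases "z \<ge> 0")
  case True
  then show ?thesis using assms exp_bound by auto
next
  case False
  define y where "y = - z"
  have y: "y > 0" using False by (simp add: y_def)
  \<comment> \<open>With \<open>z = - y\<close> the claim amounts to
    \<open>1 \<le> (1 - y + y\<^sup>2) * exp y\<close>. Replacing \<open>exp y\<close> by its
    quadratic Taylor polynomial leaves a product that exceeds 1 by positive terms only.\<close>
  have "1 \<le> (1 - y + y\<^sup>2) * (1 + y + y\<^sup>2 / 2)"
  proof -
    have "(1 - y + y\<^sup>2) * (1 + y + y\<^sup>2 / 2) = 1 + (y\<^sup>2 + y^3 + y^4) / 2"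
      by (simp add: field_simps power2_eq_square power3_eq_cube power4_eq_xxxx)
    then show ?thesis using y by simp
  qed
  also have "\<dots> \<le> (1 - y + y\<^sup>2) * exp y"
  proof (rule mult_left_mono)
    show "1 + y + y\<^sup>2 / 2 \<le> exp y" using y by (intro exp_lower_Taylor_quadratic) auto
    have "1 - y + y\<^sup>2 = (1 - y / 2)\<^sup>2 + 3 / 4 * y\<^sup>2" by (simp add: power2_eq_square algebra_simps)
    then show "0 \<le> 1 - y + y\<^sup>2" by simp
  qed
  finally have "exp (- y) \<le> 1 - y + y\<^sup>2" by (simp add: exp_minus field_simps)
  then show ?thesis by (simp add: y_def)
qed

text \<open>Think of \<open>U\<close> as the current value and \<open>X\<close> as the next
  increment. Since \<open>exp (a * U)\<close> is measurable with respect to \<open>F\<close>, the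
  quadratic bound on \<open>exp (a * X)\<close> may be integrated with \<open>X\<close> and its
  square replaced by their conditional expectations. The drift bound and
  \<open>1 + x \<le> exp x\<close> then absorb everything into one exponential, whose parameter has
  moved from \<open>a\<close> to \<open>a + c\<close>.\<close>

lemma (in finite_measure_subalgebra) mgf_step:
  fixes U X :: "'a \<Rightarrow> real" and a c d :: real
  assumes U [measurable]: "U \<in> borel_measurable F" and X [measurable]: "X \<in> borel_measurable M"
    and bdd: "AE \<omega> in M. \<bar>X \<omega>\<bar> \<le> 1"
    and a: "\<bar>a\<bar> \<le> 1"
    and drift: "AE \<omega> in M. a * real_cond_exp M F X \<omega> + a\<^sup>2 * real_cond_exp M F (\<lambda>\<omega>. (X \<omega>)\<^sup>2) \<omega>
                  \<le> c * U \<omega> + d"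
    and int_a: "integrable M (\<lambda>\<omega>. exp (a * U \<omega>))"
    and int_ac: "integrable M (\<lambda>\<omega>. exp ((a + c) * U \<omega>))"
  shows "integrable M (\<lambda>\<omega>. exp (a * (U \<omega> + X \<omega>)))"
    and "(\<integral>\<omega>. exp (a * (U \<omega> + X \<omega>)) \<partial>M) \<le> exp d * (\<integral>\<omega>. exp ((a + c) * U \<omega>) \<partial>M)"
proof -
  have [measurable]: "U \<in> borel_measurable M" by (rule measurable_from_subalg[OF subalg U])
  let ?e = "\<lambda>\<omega>. exp (a * U \<omega>)"
  let ?E1 = "real_cond_exp M F X" and ?E2 = "real_cond_exp M F (\<lambda>\<omega>. (X \<omega>)\<^sup>2)"
  have [measurable]: "?e \<in> borel_measurable F" by measurable
  have sq: "AE \<omega> in M. \<bar>(X \<omega>)\<^sup>2\<bar> \<le> 1"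
    using bdd by eventually_elim (simp add: abs_square_le_1)
  \<comment> \<open>An integrable weight times an essentially bounded factor stays integrable. This
    serves the factors \<open>X\<close>, its square and \<open>exp (a * X)\<close>.\<close>
  have int_bdd: "integrable M (\<lambda>\<omega>. ?e \<omega> * g \<omega>)"
    if [measurable]: "g \<in> borel_measurable M" and g: "AE \<omega> in M. \<bar>g \<omega>\<bar> \<le> K" for g K
  proof (rule Bochner_Integration.integrable_bound[of _ "\<lambda>\<omega>. K * ?e \<omega>"])
    show "integrable M (\<lambda>\<omega>. K * ?e \<omega>)" using int_a by simp
    show "AE \<omega> in M. norm (?e \<omega> * g \<omega>) \<le> norm (K * ?e \<omega>)"
      using g by eventually_elim (simp add: abs_mult mult.commute)
  qed measurable
  note int1 = int_bdd[OF X bdd]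
  have int2: "integrable M (\<lambda>\<omega>. ?e \<omega> * (X \<omega>)\<^sup>2)" by (rule int_bdd[OF _ sq]) measurable
  note ce1 = real_cond_exp_intg[OF int1] and ce2 = real_cond_exp_intg[OF int2]
  have az: "AE \<omega> in M. \<bar>a * X \<omega>\<bar> \<le> 1"
    using bdd by eventually_elim (use a in \<open>auto simp: abs_mult intro: mult_le_one\<close>)
  have "AE \<omega> in M. \<bar>exp (a * X \<omega>)\<bar> \<le> exp 1"
    using az by eventually_elim auto
  then have "integrable M (\<lambda>\<omega>. ?e \<omega> * exp (a * X \<omega>))" by (intro int_bdd) measurable
  then show int: "integrable M (\<lambda>\<omega>. exp (a * (U \<omega> + X \<omega>)))"
    by (simp add: distrib_left exp_add)
  have "(\<integral>\<omega>. exp (a * (U \<omega> + X \<omega>)) \<partial>M)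
      \<le> (\<integral>\<omega>. ?e \<omega> + a * (?e \<omega> * X \<omega>) + a\<^sup>2 * (?e \<omega> * (X \<omega>)\<^sup>2) \<partial>M)"
  proof (rule integral_mono_AE[OF int])
    show "AE \<omega> in M. exp (a * (U \<omega> + X \<omega>))
            \<le> ?e \<omega> + a * (?e \<omega> * X \<omega>) + a\<^sup>2 * (?e \<omega> * (X \<omega>)\<^sup>2)"
      using az
    proof eventually_elim
      case (elim \<omega>)
      have "exp (a * (U \<omega> + X \<omega>)) \<le> ?e \<omega> * (1 + a * X \<omega> + (a * X \<omega>)\<^sup>2)"
        using mult_left_mono[OF exp_le_quadratic[OF elim], of "?e \<omega>"]
        by (simp add: distrib_left exp_add)
      then show ?case by (simp add: algebra_simps power_mult_distrib)
    qed
  qed (use int_a int1 int2 in simp)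
  also have "\<dots> = (\<integral>\<omega>. ?e \<omega> + a * (?e \<omega> * ?E1 \<omega>) + a\<^sup>2 * (?e \<omega> * ?E2 \<omega>) \<partial>M)"
    using int_a int1 int2 ce1 ce2 by simp
  also have "\<dots> \<le> (\<integral>\<omega>. exp d * exp ((a + c) * U \<omega>) \<partial>M)"
  proof (rule integral_mono_AE)
    show "AE \<omega> in M. ?e \<omega> + a * (?e \<omega> * ?E1 \<omega>) + a\<^sup>2 * (?e \<omega> * ?E2 \<omega>)
            \<le> exp d * exp ((a + c) * U \<omega>)"
      using drift
    proof eventually_elim
      case (elim \<omega>)
      have "1 + (a * ?E1 \<omega> + a\<^sup>2 * ?E2 \<omega>) \<le> exp (c * U \<omega> + d)"
        using elim exp_ge_add_one_self[of "c * U \<omega> + d"] by linarith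
      then have "?e \<omega> * (1 + (a * ?E1 \<omega> + a\<^sup>2 * ?E2 \<omega>)) \<le> ?e \<omega> * exp (c * U \<omega> + d)"
        by simp
      then show ?case by (simp add: algebra_simps exp_add)
    qed
  qed (use int_a int_ac ce1 ce2 in simp_all)
  finally show "(\<integral>\<omega>. exp (a * (U \<omega> + X \<omega>)) \<partial>M) \<le> exp d * (\<integral>\<omega>. exp ((a + c) * U \<omega>) \<partial>M)"
    by simp
qed

section \<open>The sigma-algebra of the past and iteration over time\<close>

lemma sets_past_algebra:
  "sets (past_algebra M Y t)
     = sigma_sets (space M) {Y s -` B \<inter> space M | s B. s < t \<and> B \<in> sets borel}"
  unfolding past_algebra_def by (rule sets_measure_of) blast

lemma space_past_algebra: "space (past_algebra M Y t) = space M"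
  unfolding past_algebra_def by (rule space_measure_of) blast

lemma subalgebra_past_algebra:
  assumes "\<And>s. Y s \<in> borel_measurable M"
  shows "subalgebra M (past_algebra M Y t)"
  unfolding subalgebra_def sets_past_algebra space_past_algebra
proof (intro conjI refl sets.sigma_sets_subset subsetI)
  fix A assume "A \<in> {Y s -` B \<inter> space M | s B. s < t \<and> B \<in> sets borel}"
  then obtain s B where "A = Y s -` B \<inter> space M" "B \<in> sets borel" by blast
  then show "A \<in> sets M" using assms[of s] by (simp add: measurable_sets)
qed

lemma measurable_past_algebra:
  assumes "s < t"
  shows "Y s \<in> borel_measurable (past_algebra M Y t)"
proof (rule measurableI)
  fix B :: "real set" assume "B \<in> sets borel"
  then show "Y s -` B \<inter> space (past_algebra M Y t) \<in> sets (past_algebra M Y t)"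
    unfolding space_past_algebra sets_past_algebra using assms
    by (intro sigma_sets.Basic) blast
qed simp

text \<open>Induction on \<open>t\<close> with \<open>a\<close> arbitrary: one step replaces
  \<open>a\<close> by \<open>a + c a\<close>, so \<open>S\<close> has to be stable under this map,
  and it lies in \<open>{-1..1}\<close> so that the one-step estimate applies. The cost
  \<open>exp (d a)\<close> of the step is paid for by the drop of \<open>G\<close> from
  \<open>a\<close> to \<open>a + c a\<close>. Keeping \<open>S\<close>, \<open>c\<close>,
  \<open>d\<close>, \<open>G\<close> abstract lets both tails share the argument.\<close>

lemma mgf_bound:
  fixes Y :: "nat \<Rightarrow> 'a \<Rightarrow> real" and c d G :: "real \<Rightarrow> real" and S :: "real set"
  assumes "prob_space M"
    and Y: "\<And>s. Y s \<in> borel_measurable M"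
    and bdd: "\<And>s. s \<ge> 1 \<Longrightarrow> AE \<omega> in M. \<bar>increment Y s \<omega>\<bar> \<le> 1"
    and S: "S \<subseteq> {-1..1}" "\<And>a. a \<in> S \<Longrightarrow> a + c a \<in> S"
    and drift: "\<And>s a. s \<ge> 1 \<Longrightarrow> a \<in> S \<Longrightarrow> AE \<omega> in M.
          a * real_cond_exp M (past_algebra M Y s) (increment Y s) \<omega>
          + a\<^sup>2 * real_cond_exp M (past_algebra M Y s) (\<lambda>\<omega>. (increment Y s \<omega>)\<^sup>2) \<omega>
            \<le> c a * Y (s - 1) \<omega> + d a"
    and init: "\<And>a. a \<in> S \<Longrightarrow> integrable M (\<lambda>\<omega>. exp (a * Y 0 \<omega>))
          \<and> (\<integral>\<omega>. exp (a * Y 0 \<omega>) \<partial>M) \<le> exp (G a)"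
    and G: "\<And>a. a \<in> S \<Longrightarrow> G (a + c a) + d a \<le> G a"
    and "a \<in> S"
  shows "integrable M (\<lambda>\<omega>. exp (a * Y t \<omega>)) \<and> (\<integral>\<omega>. exp (a * Y t \<omega>) \<partial>M) \<le> exp (G a)"
  using \<open>a \<in> S\<close>
proof (induction t arbitrary: a)
  case 0
  then show ?case by (rule init)
next
  case (Suc t)
  interpret prob_space M by fact
  interpret finite_measure_subalgebra M "past_algebra M Y (Suc t)"
    by unfold_locales (rule subalgebra_past_algebra[OF Y])
  have b: "a + c a \<in> S" by (rule S(2)[OF Suc.prems])
  have X: "increment Y (Suc t) \<in> borel_measurable M"
    using Y unfolding increment_def[abs_def] by measurable
  have "a \<in> {-1..1}" using S(1) Suc.prems by blast
  then have "\<bar>a\<bar> \<le> 1" by auto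
  \<comment> \<open>The past at index \<open>Suc t\<close> is generated by \<open>Y 0\<close> up to
    \<open>Y t\<close>, so \<open>Y t\<close> can play the role of \<open>U\<close>. The induction
    hypothesis is needed at \<open>a\<close> for integrability and again at
    \<open>a + c a\<close>.\<close>
  note step = mgf_step[OF measurable_past_algebra[of t "Suc t" Y] X bdd[of "Suc t"] this
      drift[of "Suc t" a, simplified diff_Suc_1], simplified, OF Suc.prems
      Suc.IH[OF Suc.prems, THEN conjunct1] Suc.IH[OF b, THEN conjunct1]]
  have eq: "Y t \<omega> + increment Y (Suc t) \<omega> = Y (Suc t) \<omega>" for \<omega> by (simp add: increment_def)
  have "(\<integral>\<omega>. exp (a * Y (Suc t) \<omega>) \<partial>M) \<le> exp (d a) * (\<integral>\<omega>. exp ((a + c a) * Y t \<omega>) \<partial>M)"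
    using step(2) by (simp add: eq)
  also have "\<dots> \<le> exp (d a) * exp (G (a + c a))"
    using Suc.IH[OF b] by simp
  also have "\<dots> \<le> exp (G a)"
    using G[OF Suc.prems] by (simp flip: exp_add add: add.commute)
  finally show ?case using step(1) by (simp add: eq)
qed

section \<open>Potential functions and the choice of exponents\<close>

lemma upper_potential_decrease:
  fixes a \<gamma> \<mu> v :: real
  assumes a: "0 \<le> a" "a < 1" and \<gamma>: "0 < \<gamma>" "\<gamma> \<le> 1" and "\<mu> \<ge> 0" "v \<ge> 0"
    and b: "b = a - \<gamma> * a * (1 - a)"
  shows "\<mu> * b + (\<mu> + v) * b\<^sup>2 / (1 - b) + \<gamma> * (\<mu> * a + v * a\<^sup>2)
           \<le> \<mu> * a + (\<mu> + v) * a\<^sup>2 / (1 - a)"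
proof -
  have "\<gamma> * (a * (1 - a)) \<le> 1 * (a * (1 - a))" using a \<gamma> by (intro mult_right_mono) auto
  also have "\<dots> \<le> a" using a by (simp add: algebra_simps)
  finally have b0: "b \<ge> 0" by (simp add: b)
  have "0 \<le> \<gamma> * a * (1 - a)" using a \<gamma> by simp
  then have b1: "b < 1" using a by (simp add: b)
  have ab: "a - b = \<gamma> * a * (1 - a)" by (simp add: b)
  \<comment> \<open>The linear term drops by only \<open>\<gamma> * \<mu> * a * (1 - a)\<close>,
    which falls short of \<open>\<gamma> * \<mu> * a\<close>. The rational term must therefore
    supply both this deficit and \<open>\<gamma> * v * a\<^sup>2\<close>, hence its coefficient
    \<open>\<mu> + v\<close>. Its pole at 1 cancels the factor \<open>1 - a\<close> of
    \<open>a - b\<close>.\<close>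
  have "a\<^sup>2 / (1 - a) - b\<^sup>2 / (1 - b) = (a - b) * (a + b - a * b) / ((1 - a) * (1 - b))"
    using a b1 by (simp add: divide_simps) (simp add: algebra_simps power2_eq_square)
  also have "\<dots> = \<gamma> * a * ((a + b - a * b) / (1 - b))"
    using a b1 by (simp add: ab)
  \<comment> \<open>Here \<open>a + b - a * b\<close> exceeds \<open>a * (1 - b)\<close> by exactly
    \<open>b\<close>, which is nonnegative.\<close>
  also have "\<dots> \<ge> \<gamma> * a * a"
    using a b0 b1 \<gamma> by (intro mult_left_mono) (auto simp: pos_le_divide_eq algebra_simps)
  finally have "(\<mu> + v) * (\<gamma> * a * a) \<le> (\<mu> + v) * (a\<^sup>2 / (1 - a) - b\<^sup>2 / (1 - b))"
    using assms by (intro mult_left_mono) auto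
  moreover have "\<mu> * a - \<mu> * b = \<gamma> * \<mu> * a - \<gamma> * \<mu> * (a * a)" by (simp add: b algebra_simps)
  ultimately show ?thesis by (simp add: algebra_simps power2_eq_square)
qed

text \<open>Here \<open>b\<close> is the contracted value of \<open>a\<close> after the sign change
  for the lower tail. As \<open>1 + a \<le> 2\<close>, the bound \<open>\<gamma> \<le> 1 / 2\<close>
  keeps \<open>b\<close> from overshooting 0. The linear term now drops by
  \<open>\<gamma> * \<mu> * a * (1 + a)\<close>, more than enough for its share of the cost, so a
  plain quadratic suffices for the rest.\<close>

lemma lower_potential_decrease:
  fixes a \<gamma> \<mu> v :: real
  assumes a: "0 \<le> a" "a \<le> 1" and \<gamma>: "0 < \<gamma>" "\<gamma> \<le> 1 / 2" and "\<mu> \<ge> 0" "v \<ge> 0"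
    and b: "b = a - \<gamma> * a * (1 + a)"
  shows "b \<ge> 0"
    and "\<mu> * b + v * b\<^sup>2 + \<gamma> * (\<mu> * a + v * a\<^sup>2) \<le> \<mu> * a + v * a\<^sup>2"
proof -
  have "\<gamma> * (a * (1 + a)) \<le> 1 / 2 * (a * (1 + a))" using a \<gamma> by (intro mult_right_mono) auto
  also have "\<dots> \<le> a" using a by (simp add: field_simps mult_left_le_one_le)
  finally show b0: "b \<ge> 0" by (simp add: b)
  have "\<gamma> * a * a \<le> \<gamma> * a * ((1 + a) * (a + b))"
    using a b0 \<gamma> by (intro mult_left_mono) (auto simp: algebra_simps)
  also have "\<dots> = a\<^sup>2 - b\<^sup>2" by (simp add: b power2_eq_square algebra_simps)
  finally have "v * (\<gamma> * a * a) \<le> v * (a\<^sup>2 - b\<^sup>2)" using assms by (intro mult_left_mono) auto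
  moreover have "\<mu> * a - \<mu> * b = \<gamma> * \<mu> * a + \<gamma> * \<mu> * (a * a)" by (simp add: b algebra_simps)
  moreover have "0 \<le> \<gamma> * \<mu> * (a * a)" using assms by simp
  ultimately show "\<mu> * b + v * b\<^sup>2 + \<gamma> * (\<mu> * a + v * a\<^sup>2) \<le> \<mu> * a + v * a\<^sup>2"
    by (simp add: algebra_simps power2_eq_square)
qed

text \<open>This \<open>a\<close> makes the loss \<open>w * a\<^sup>2 / (1 - a)\<close> equal to
  half the gain \<open>a * \<eta>\<close>, so that \<open>- a * \<eta> / 2\<close> remains.\<close>

lemma upper_exponent:
  fixes \<eta> w :: real
  assumes "\<eta> > 0" "w > 0" and a: "a = \<eta> / (\<eta> + 2 * w)"
  shows "w * a\<^sup>2 / (1 - a) - a * \<eta> = - (\<eta>\<^sup>2 / (4 * w + 2 * \<eta>))"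
proof -
  define D where "D = \<eta> + 2 * w"
  have D: "D > 0" using assms(1,2) by (simp add: D_def)
  have *: "1 - a = 2 * w / D" "a = \<eta> / D" using D by (simp_all add: a D_def field_simps)
  have "w * a\<^sup>2 / (1 - a) - a * \<eta> = w * (\<eta> / D)\<^sup>2 / (2 * w / D) - \<eta> / D * \<eta>"
    unfolding *(1) unfolding *(2) ..
  also have "\<dots> = - (\<eta>\<^sup>2 / (2 * D))"
    using D assms(2) by (simp add: field_simps power2_eq_square)
  finally show ?thesis by (simp add: D_def algebra_simps)
qed

text \<open>The chosen \<open>a\<close> minimizes the left side over \<open>{0..1}\<close>. The
  interior minimum is \<open>- (\<eta>\<^sup>2 / (4 * v))\<close>; at the boundary point 1 the value
  is \<open>v - \<eta>\<close>, and the claim reduces to \<open>4 * v \<le> 3 * \<eta>\<close>,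
  which follows from \<open>\<eta> > 2 * v\<close>. The denominator \<open>4 * v + \<eta>\<close>
  covers both regimes.\<close>

lemma lower_exponent:
  fixes \<eta> v :: real
  assumes "\<eta> > 0" "v > 0" and a: "a = min 1 (\<eta> / (2 * v))"
  shows "v * a\<^sup>2 - a * \<eta> \<le> - (\<eta>\<^sup>2 / (4 * v + \<eta>))"
proof (cases "\<eta> \<le> 2 * v")
  case True
  then have "a = \<eta> / (2 * v)" using assms by simp
  moreover have "v * (\<eta> / (2 * v))\<^sup>2 - \<eta> / (2 * v) * \<eta> = - (\<eta>\<^sup>2 / (4 * v))"
    using assms(1,2) by (simp add: power2_eq_square)
  ultimately have "v * a\<^sup>2 - a * \<eta> = - (\<eta>\<^sup>2 / (4 * v))" by simp
  also have "\<dots> \<le> - (\<eta>\<^sup>2 / (4 * v + \<eta>))" using assms by (simp add: frac_le)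
  finally show ?thesis .
next
  case False
  then have "a = 1" using assms(2) by (simp add: a)
  moreover have "\<eta>\<^sup>2 / (4 * v + \<eta>) \<le> \<eta> - v"
  proof -
    have "v * (4 * v) \<le> v * (3 * \<eta>)" using False assms by (intro mult_left_mono) auto
    then have "\<eta>\<^sup>2 \<le> (\<eta> - v) * (4 * v + \<eta>)" by (simp add: power2_eq_square algebra_simps)
    then show ?thesis using assms(1,2) by (simp add: pos_divide_le_eq)
  qed
  ultimately show ?thesis by simp
qed

section \<open>Tail bounds by Chernoff's inequality\<close>

theorem theorem2p7:
  fixes M :: "'a measure" and Y :: "nat \<Rightarrow> 'a \<Rightarrow> real"
    and \<gamma> \<beta>\<^sub>u \<beta>\<^sub>l \<sigma> \<eta> :: real and t :: nat
  assumes "prob_space M"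
    and "\<And>s. Y s \<in> borel_measurable M"
    and "0 < \<gamma>" and "\<gamma> \<le> 1 / 2"
    and "\<beta>\<^sub>u \<ge> 0" and "\<beta>\<^sub>l \<ge> 0" and "\<sigma> > 0"
    and "\<And>s. s \<ge> 1 \<Longrightarrow> AE \<omega> in M. \<bar>increment Y s \<omega>\<bar> \<le> 1"
    and "\<And>s. s \<ge> 1 \<Longrightarrow> AE \<omega> in M.
          - \<gamma> * Y (s - 1) \<omega> - \<beta>\<^sub>l \<le> real_cond_exp M (past_algebra M Y s) (increment Y s) \<omega>
          \<and> real_cond_exp M (past_algebra M Y s) (increment Y s) \<omega> \<le> - \<gamma> * Y (s - 1) \<omega> + \<beta>\<^sub>u"
    and "\<And>s. s \<ge> 1 \<Longrightarrow> AE \<omega> in M.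
          real_cond_exp M (past_algebra M Y s) (\<lambda>\<omega>. (increment Y s \<omega>)\<^sup>2) \<omega>
            \<le> \<gamma> * Y (s - 1) \<omega> + \<sigma>"
    and "\<And>a. a \<in> {-1..1} \<Longrightarrow> integrable M (\<lambda>\<omega>. exp (a * Y 0 \<omega>))
          \<and> prob_space.expectation M (\<lambda>\<omega>. exp (a * Y 0 \<omega>)) \<le> exp (a\<^sup>2 * \<sigma> / \<gamma>)"
    and "\<eta> > 0"
  shows "\<P>(\<omega> in M. Y t \<omega> \<ge> \<beta>\<^sub>u / \<gamma> + \<eta>)
           \<le> exp (- (\<eta>\<^sup>2 / (4 * (\<sigma> + \<beta>\<^sub>u) / \<gamma> + 2 * \<eta>)))
       \<and> \<P>(\<omega> in M. Y t \<omega> \<le> - (\<beta>\<^sub>l / \<gamma>) - \<eta>)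
           \<le> exp (- (\<eta>\<^sup>2 / (4 * \<sigma> / \<gamma> + \<eta>)))"
proof -
  interpret prob_space M by fact
  note [measurable] = assms(2)
  have \<gamma>: "0 < \<gamma>" "\<gamma> \<le> 1 / 2" by fact+
  \<comment> \<open>Dividing by \<open>\<gamma>\<close> puts the factor \<open>\<gamma>\<close> into
    both the contraction of \<open>a\<close> and the cost \<open>d a\<close>, as the potential
    inequalities require.\<close>
  define \<mu> v \<nu> where "\<mu> = \<beta>\<^sub>u / \<gamma>" and "v = \<sigma> / \<gamma>" and "\<nu> = \<beta>\<^sub>l / \<gamma>"
  have nonneg: "\<mu> \<ge> 0" "v > 0" "\<nu> \<ge> 0"
    using assms(3-7) by (simp_all add: \<mu>_def v_def \<nu>_def)
  have eqs: "\<beta>\<^sub>u = \<gamma> * \<mu>" "\<sigma> = \<gamma> * v" "\<beta>\<^sub>l = \<gamma> * \<nu>"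
    using \<gamma> by (simp_all add: \<mu>_def v_def \<nu>_def)

  have "prob {\<omega> \<in> space M. \<mu> + \<eta> \<le> Y t \<omega>} \<le> exp (- (\<eta>\<^sup>2 / (4 * (\<mu> + v) + 2 * \<eta>)))"
  proof -
    define a where "a = \<eta> / (\<eta> + 2 * (\<mu> + v))"
    define G where "G = (\<lambda>a. \<mu> * a + (\<mu> + v) * a\<^sup>2 / (1 - a))"
    have a: "0 < a" "a < 1" using nonneg assms(12) by (simp_all add: a_def)
    have "integrable M (\<lambda>\<omega>. exp (a * Y t \<omega>)) \<and> (\<integral>\<omega>. exp (a * Y t \<omega>) \<partial>M) \<le> exp (G a)"
    \<comment> \<open>For \<open>a \<ge> 0\<close> the upper drift bound gives \<open>a * (-
      \<gamma> * y + \<beta>\<^sub>u) + a\<^sup>2 * (\<gamma> * y + \<sigma>)\<close>, where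
      \<open>y\<close> is the previous value. Collecting the terms in \<open>y\<close> yields
      \<open>c\<close>, and the constants form \<open>d\<close>. The interval is half-open because
      \<open>G\<close> has a pole at 1.\<close>
    proof (rule mgf_bound[where S = "{0..<1}" and G = G and c = "\<lambda>a. - (\<gamma> * a * (1 - a))"
          and d = "\<lambda>a. \<gamma> * (\<mu> * a + v * a\<^sup>2)"])
      fix a :: real assume a: "a \<in> {0..<1}"
      have "\<gamma> * (a * (1 - a)) \<le> 1 * (a * (1 - a))" using a \<gamma> by (intro mult_right_mono) auto
      also have "\<dots> \<le> a" using a by (simp add: algebra_simps)
      finally have "\<gamma> * a * (1 - a) \<le> a" by simp
      moreover have "0 \<le> \<gamma> * a * (1 - a)" using a \<gamma> by simp
      ultimately show "a + - (\<gamma> * a * (1 - a)) \<in> {0..<1}" using a by auto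
      show "G (a + - (\<gamma> * a * (1 - a))) + \<gamma> * (\<mu> * a + v * a\<^sup>2) \<le> G a"
        using upper_potential_decrease[of a \<gamma> \<mu> v] a \<gamma> nonneg by (simp add: G_def)
      \<comment> \<open>At time 0 the assumed exponent is \<open>v * a\<^sup>2\<close>, and
        \<open>G a\<close> dominates it because \<open>1 - a \<le> 1\<close>.\<close>
      have "a\<^sup>2 * (1 - a) \<le> a\<^sup>2" using a by (simp add: mult_left_le)
      then have "a\<^sup>2 \<le> a\<^sup>2 / (1 - a)" using a by (simp add: pos_le_divide_eq)
      then have "v * a\<^sup>2 \<le> v * (a\<^sup>2 / (1 - a))" using nonneg by (intro mult_left_mono) auto
      moreover have "0 \<le> \<mu> * a" "0 \<le> \<mu> * (a\<^sup>2 / (1 - a))" using a nonneg by auto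
      ultimately have "a\<^sup>2 * \<sigma> / \<gamma> \<le> G a"
        using \<gamma> by (simp add: G_def eqs algebra_simps add_divide_distrib)
      then show "integrable M (\<lambda>\<omega>. exp (a * Y 0 \<omega>)) \<and> (\<integral>\<omega>. exp (a * Y 0 \<omega>) \<partial>M) \<le> exp (G a)"
        using assms(11)[of a] a by (auto elim!: order_trans)
      fix s :: nat assume s: "s \<ge> 1"
      show "AE \<omega> in M. a * real_cond_exp M (past_algebra M Y s) (increment Y s) \<omega>
          + a\<^sup>2 * real_cond_exp M (past_algebra M Y s) (\<lambda>\<omega>. (increment Y s \<omega>)\<^sup>2) \<omega>
            \<le> - (\<gamma> * a * (1 - a)) * Y (s - 1) \<omega> + \<gamma> * (\<mu> * a + v * a\<^sup>2)"
        using assms(9)[OF s] assms(10)[OF s]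
      proof eventually_elim
        case (elim \<omega>)
        have "a * real_cond_exp M (past_algebra M Y s) (increment Y s) \<omega>
            \<le> a * (- \<gamma> * Y (s - 1) \<omega> + \<beta>\<^sub>u)" using elim a by (intro mult_left_mono) auto
        moreover have "a\<^sup>2 * real_cond_exp M (past_algebra M Y s) (\<lambda>\<omega>. (increment Y s \<omega>)\<^sup>2) \<omega>
            \<le> a\<^sup>2 * (\<gamma> * Y (s - 1) \<omega> + \<sigma>)" using elim by (intro mult_left_mono) auto
        ultimately show ?case by (simp add: eqs algebra_simps power2_eq_square)
      qed
    qed (use assms a in auto)
    then have int: "integrable M (\<lambda>\<omega>. exp (a * Y t \<omega>))"
      and mgf: "(\<integral>\<omega>. exp (a * Y t \<omega>) \<partial>M) \<le> exp (G a)" by auto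
    have "prob {\<omega> \<in> space M. \<mu> + \<eta> \<le> Y t \<omega>}
        \<le> exp (- a * (\<mu> + \<eta>)) * (\<integral>\<omega>\<in>space M. exp (a * Y t \<omega>) \<partial>M)"
      using a int by (intro Chernoff_ineq_ge) (auto simp: set_integrable_def integrable_mult_indicator simp del: real_scaleR_def)
    also have "\<dots> = exp (- a * (\<mu> + \<eta>)) * (\<integral>\<omega>. exp (a * Y t \<omega>) \<partial>M)"
      using int by (simp add: set_integral_space)
    also have "\<dots> \<le> exp (- a * (\<mu> + \<eta>)) * exp (G a)" using mgf by simp
    \<comment> \<open>The linear part \<open>\<mu> * a\<close> of \<open>G\<close> cancels against
      the shift of the threshold by \<open>\<mu>\<close>.\<close>
    also have "\<dots> = exp ((\<mu> + v) * a\<^sup>2 / (1 - a) - a * \<eta>)"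
      by (simp flip: exp_add add: G_def algebra_simps)
    also have "(\<mu> + v) * a\<^sup>2 / (1 - a) - a * \<eta> = - (\<eta>\<^sup>2 / (4 * (\<mu> + v) + 2 * \<eta>))"
      by (rule upper_exponent) (use nonneg assms(12) a_def in auto)
    finally show ?thesis .
  qed
  moreover have "prob {\<omega> \<in> space M. Y t \<omega> \<le> - \<nu> - \<eta>} \<le> exp (- (\<eta>\<^sup>2 / (4 * v + \<eta>)))"
  proof -
    define a where "a = min 1 (\<eta> / (2 * v))"
    \<comment> \<open>The parameter of the moment generating function is now negative, so the
      potential is written in terms of \<open>- a\<close>.\<close>
    define G where "G = (\<lambda>a. \<nu> * (- a) + v * (- a)\<^sup>2)"
    have a: "0 < a" "a \<le> 1" using nonneg assms(12) by (simp_all add: a_def)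
    have "integrable M (\<lambda>\<omega>. exp (- a * Y t \<omega>)) \<and> (\<integral>\<omega>. exp (- a * Y t \<omega>) \<partial>M) \<le> exp (G (- a))"
    proof (rule mgf_bound[where S = "{-1..0}" and G = G and c = "\<lambda>a. \<gamma> * (- a) * (1 + - a)"
          and d = "\<lambda>a. \<gamma> * (\<nu> * (- a) + v * (- a)\<^sup>2)"])
      fix a :: real assume a: "a \<in> {-1..0}"
      note decrease = lower_potential_decrease[of "- a" \<gamma> \<nu> v, OF _ _ \<gamma> nonneg(3) _ refl]
      have "0 \<le> \<gamma> * (- a) * (1 + - a)" using a \<gamma> by (intro mult_nonneg_nonneg) auto
      then show "a + \<gamma> * (- a) * (1 + - a) \<in> {-1..0}" using a decrease(1) nonneg by auto
      have "- (a + \<gamma> * (- a) * (1 + - a)) = - a - \<gamma> * (- a) * (1 + - a)" by simp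
      then show "G (a + \<gamma> * (- a) * (1 + - a)) + \<gamma> * (\<nu> * (- a) + v * (- a)\<^sup>2) \<le> G a"
        using decrease(2) a nonneg unfolding G_def by (simp del: power2_minus mult_minus_right)
      have "0 \<le> \<nu> * (- a)" using a nonneg by (intro mult_nonneg_nonneg) auto
      then have "a\<^sup>2 * \<sigma> / \<gamma> \<le> G a" using \<gamma> by (simp add: G_def eqs algebra_simps)
      then show "integrable M (\<lambda>\<omega>. exp (a * Y 0 \<omega>)) \<and> (\<integral>\<omega>. exp (a * Y 0 \<omega>) \<partial>M) \<le> exp (G a)"
        using assms(11)[of a] a by (auto elim!: order_trans)
      fix s :: nat assume s: "s \<ge> 1"
      show "AE \<omega> in M. a * real_cond_exp M (past_algebra M Y s) (increment Y s) \<omega>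
          + a\<^sup>2 * real_cond_exp M (past_algebra M Y s) (\<lambda>\<omega>. (increment Y s \<omega>)\<^sup>2) \<omega>
            \<le> \<gamma> * (- a) * (1 + - a) * Y (s - 1) \<omega> + \<gamma> * (\<nu> * (- a) + v * (- a)\<^sup>2)"
        using assms(9)[OF s] assms(10)[OF s]
      proof eventually_elim
        case (elim \<omega>)
        \<comment> \<open>Multiplication by \<open>a \<le> 0\<close> reverses the inequality, so the
          lower drift bound with \<open>\<beta>\<^sub>l\<close> is the one used.\<close>
        have "a * real_cond_exp M (past_algebra M Y s) (increment Y s) \<omega>
            \<le> a * (- \<gamma> * Y (s - 1) \<omega> - \<beta>\<^sub>l)" using elim a by (intro mult_left_mono_neg) auto
        moreover have "a\<^sup>2 * real_cond_exp M (past_algebra M Y s) (\<lambda>\<omega>. (increment Y s \<omega>)\<^sup>2) \<omega>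
            \<le> a\<^sup>2 * (\<gamma> * Y (s - 1) \<omega> + \<sigma>)" using elim by (intro mult_left_mono) auto
        ultimately show ?case by (simp add: eqs algebra_simps power2_eq_square)
      qed
    qed (use assms a in auto)
    then have int: "integrable M (\<lambda>\<omega>. exp (- a * Y t \<omega>))"
      and mgf: "(\<integral>\<omega>. exp (- a * Y t \<omega>) \<partial>M) \<le> exp (G (- a))" by auto
    have "prob {\<omega> \<in> space M. Y t \<omega> \<le> - \<nu> - \<eta>}
        \<le> exp (a * (- \<nu> - \<eta>)) * (\<integral>\<omega>\<in>space M. exp (- a * Y t \<omega>) \<partial>M)"
      using a int by (intro Chernoff_ineq_le) (auto simp: set_integrable_def integrable_mult_indicator simp del: real_scaleR_def)
    also have "\<dots> = exp (a * (- \<nu> - \<eta>)) * (\<integral>\<omega>. exp (- a * Y t \<omega>) \<partial>M)"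
      using int by (simp add: set_integral_space)
    also have "\<dots> \<le> exp (a * (- \<nu> - \<eta>)) * exp (G (- a))"
      using mgf by (intro mult_left_mono) auto
    also have "\<dots> = exp (v * a\<^sup>2 - a * \<eta>)"
      by (simp flip: exp_add add: G_def algebra_simps)
    also have "\<dots> \<le> exp (- (\<eta>\<^sup>2 / (4 * v + \<eta>)))"
      using lower_exponent[OF assms(12) nonneg(2) a_def] by simp
    finally show ?thesis .
  qed
  moreover have "4 * (\<mu> + v) = 4 * (\<sigma> + \<beta>\<^sub>u) / \<gamma>" "4 * v = 4 * \<sigma> / \<gamma>"
    by (simp_all add: \<mu>_def v_def add_divide_distrib)
  ultimately show ?thesis by (simp add: \<mu>_def \<nu>_def)
qed

end
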